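(* Let $n\ge 2$ be an integer and write $\mathrm{rad}(n)=p_1\cdots p_k$ with $p_1,\dots,p_k$ distinct primes. Then $$\mathrm{Cond}(V_{\Phi_n})\le 2\,\mathrm{rad}(n)\,n^{2^k+k+2}A(n).$$
   Context: For $n\ge 2$, $\Phi_n$ is the $n$-th cyclotomic polynomial, $m=\phi(n)$ its degree ($\phi$ is Euler's totient), and $\zeta_1,\dots,\zeta_m\in\mathbb{C}$ are the primitive $n$-th roots of unity (in any fixed order). $V_{\Phi_n}$ is the $m\times m$ Vandermonde matrix whose $(i,j)$ entry is $\zeta_i^{\,j-1}$, $1\le i,j\le m$. For a complex matrix $A=(a_{ij})$, $\|A\|=\sqrt{\sum_{i,j}|a_{ij}|^2}$ is the Frobenius norm, and for invertible $A$, $\mathrm{Cond}(A)=\|A\|\,\|A^{-1}\|$. $\mathrm{rad}(n)$ is the product of the distinct primes dividing $n$. $A(n)$ denotes the maximum of the absolute values of the coefficients of $\Phi_n$. *)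

theory Defs
  imports
    Complex_Main
    "HOL-Number_Theory.Totient"
    "HOL-Computational_Algebra.Polynomial"
    "Jordan_Normal_Form.Gauss_Jordan_Elimination"
    "Jordan_Normal_Form.Determinant"
begin

definition primitive_roots_unity :: "nat \<Rightarrow> complex set" where
  "primitive_roots_unity n = {z. z ^ n = 1 \<and> (\<forall>k. 0 < k \<and> k < n \<longrightarrow> z ^ k \<noteq> 1)}"

definition cyclotomic :: "nat \<Rightarrow> complex poly" where
  "cyclotomic n = (\<Prod>z\<in>primitive_roots_unity n. [:- z, 1:])"

text \<open>The coefficients of a cyclotomic polynomial are integers, but the product above lives over the
  complex numbers, so the absolute value of a coefficient appears here as the complex modulus.\<close>

definition cyclotomic_height :: "nat \<Rightarrow> real" where
  "cyclotomic_height n = Max ((\<lambda>i. cmod (coeff (cyclotomic n) i)) ` {..degree (cyclotomic n)})"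

definition rad :: "nat \<Rightarrow> nat" where
  "rad n = \<Prod>(prime_factors n)"

text \<open>Matrix indices start at 0, so the entry \<open>\<zeta>\<^sub>i\<^sup>j\<^sup>-\<^sup>1\<close> of the 1-based convention becomes
  \<open>\<zeta> i ^ j\<close>.\<close>

definition vandermonde_mat :: "nat \<Rightarrow> (nat \<Rightarrow> complex) \<Rightarrow> complex mat" where
  "vandermonde_mat m \<zeta> = mat m m (\<lambda>(i, j). \<zeta> i ^ j)"

definition frobenius_norm :: "complex mat \<Rightarrow> real" where
  "frobenius_norm A = sqrt (\<Sum>i<dim_row A. \<Sum>j<dim_col A. (cmod (A $$ (i, j)))\<^sup>2)"

text \<open>Only meaningful for invertible matrices: \<^const>\<open>mat_inverse\<close> returns \<^const>\<open>None\<close> on the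
  others.\<close>

definition cond_number :: "complex mat \<Rightarrow> real" where
  "cond_number A = frobenius_norm A * frobenius_norm (the (mat_inverse A))"

lemma mat_inverse_invertible:
  fixes A :: "complex mat"
  assumes "invertible_mat A"
  shows "\<exists>B. mat_inverse A = Some B \<and> inverts_mat A B \<and> inverts_mat B A"
proof -
  define n where "n = dim_row A"
  have "dim_col A = dim_row A"
    using assms unfolding invertible_mat_def square_mat.simps by blast
  then have A: "A \<in> carrier_mat n n"
    unfolding n_def by (intro carrier_matI refl)
  obtain B where "inverts_mat A B" "inverts_mat B A"
    using assms unfolding invertible_mat_def by blast
  then have B: "A * B = 1\<^sub>m n" "B * A = 1\<^sub>m (dim_row B)"
    unfolding inverts_mat_def n_def .
  have "dim_col (A * B) = dim_col (1\<^sub>m n :: complex mat)"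
    by (simp only: B(1))
  then have col: "dim_col B = n"
    by simp
  have "dim_col (B * A) = dim_col (1\<^sub>m (dim_row B) :: complex mat)"
    by (simp only: B(2))
  then have row: "dim_row B = n"
    unfolding index_mult_mat index_one_mat carrier_matD(2)[OF A] ..
  have "B \<in> carrier_mat n n"
    using row col by (rule carrier_matI)
  moreover have "B * A = 1\<^sub>m n"
    using B(2) unfolding row .
  ultimately have "A \<in> Units (ring_mat TYPE(complex) n ())"
    using A B(1) unfolding Units_def ring_mat_def by auto
  then obtain C where C: "mat_inverse A = Some C"
    using mat_inverse(1)[OF A, of "()"] by blast
  have "A * C = 1\<^sub>m n" "C * A = 1\<^sub>m n" "C \<in> carrier_mat n n"
    using mat_inverse(2)[OF A C] by blast+
  then show ?thesis
    using A C by (auto simp: inverts_mat_def)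
qed

lemma invertible_vandermonde_mat:
  assumes "inj_on \<zeta> {..<m}"
  shows "invertible_mat (vandermonde_mat m \<zeta>)"
proof -
  let ?V = "vandermonde_mat m \<zeta>"
  have V: "?V \<in> carrier_mat m m"
    by (simp add: vandermonde_mat_def)
  have "det ?V \<noteq> 0"
  proof
    assume "det ?V = 0"
    then obtain v where v: "v \<in> carrier_vec m" "v \<noteq> 0\<^sub>v m" "?V *\<^sub>v v = 0\<^sub>v m"
      using det_0_iff_vec_prod_zero[OF V] by auto
    define p where "p = (\<Sum>j<m. monom (v $ j) j)"
    have coeff_p: "coeff p j = (if j < m then v $ j else 0)" for j
      by (simp add: p_def coeff_sum sum.delta)
    have "poly p (\<zeta> i) = 0" if "i < m" for i
    proof -
      have "poly p (\<zeta> i) = (?V *\<^sub>v v) $ i"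
        using that v(1)
        by (auto simp: p_def poly_sum poly_monom vandermonde_mat_def scalar_prod_def
            mult.commute lessThan_atLeast0 intro!: sum.cong)
      then show ?thesis
        using v(3) that by simp
    qed
    then have roots: "\<zeta> ` {..<m} \<subseteq> {x. poly p x = 0}"
      by auto
    have "p = 0"
    proof (rule ccontr)
      assume p: "p \<noteq> 0"
      have "m \<le> card {x. poly p x = 0}"
        using card_mono[OF poly_roots_finite[OF p] roots] card_image[OF assms] by simp
      also have "\<dots> \<le> degree p"
        by (rule card_poly_roots_bound[OF p])
      finally have "coeff p (degree p) = 0"
        by (simp add: coeff_p)
      with p show False
        by simp
    qed
    then have "v = 0\<^sub>v m"
      using v(1) coeff_p by (intro eq_vecI) (auto split: if_splits, metis)
    with v(2) show False
      by contradiction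
  qed
  then show ?thesis
    using V det_non_zero_imp_unit[OF V, of "()"]
    by (auto simp: invertible_mat_def inverts_mat_def Units_def ring_mat_def)
qed

lemma bij_betw_primitive_roots_unity:
  assumes "n \<ge> 2"
  shows "bij_betw (\<lambda>k. cis (2 * pi * real k / real n)) (totatives n) (primitive_roots_unity n)"
proof -
  let ?c = "\<lambda>k::nat. cis (2 * pi * real k / real n)"
  have n: "n > 0" using assms by simp
  have pow: "?c k ^ j = 1 \<longleftrightarrow> n dvd j * k" for k j
  proof -
    have "?c k ^ j = cis (2 * pi * real (j * k) / real n)"
      by (simp add: DeMoivre mult_ac)
    also have "\<dots> = 1 \<longleftrightarrow> n dvd j * k"
    proof
      assume "cis (2 * pi * real (j * k) / real n) = 1"
      then have "cos (2 * pi * real (j * k) / real n) = 1"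
        by (simp add: complex_eq_iff)
      then obtain x :: int where "2 * pi * real (j * k) / real n = of_int x * 2 * pi"
        unfolding cos_one_2pi_int by blast
      then have "real (j * k) = of_int x * real n"
        using n by (simp add: field_simps)
      then have "int (j * k) = x * int n"
        by (metis of_int_eq_iff of_int_mult of_int_of_nat_eq)
      then have "int n dvd int (j * k)"
        by simp
      then show "n dvd j * k"
        by (simp only: int_dvd_int_iff)
    next
      assume "n dvd j * k"
      then obtain q where "j * k = n * q" ..
      then have "2 * pi * real (j * k) / real n = 2 * pi * of_nat q"
        using n by (simp add: field_simps flip: of_nat_mult)
      then show "cis (2 * pi * real (j * k) / real n) = 1"
        by (metis Ints_of_nat cis_multiple_2pi)
    qed
    finally show ?thesis .
  qed
  have prim: "?c k \<in> primitive_roots_unity n \<longleftrightarrow> coprime k n" for k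
  proof
    assume A: "?c k \<in> primitive_roots_unity n"
    show "coprime k n"
    proof (rule ccontr)
      assume "\<not> coprime k n"
      then have g: "gcd k n > 1"
        using n by (metis coprime_iff_gcd_eq_1 gcd_pos_nat less_one linorder_neqE_nat neq0_conv)
      have "0 < n div gcd k n" "n div gcd k n < n"
        using g n by (auto simp: div_greater_zero_iff gcd_le2_nat)
      moreover have "n dvd n div gcd k n * k"
      proof -
        have "n div gcd k n * k = n * (k div gcd k n)"
          by (metis dvd_div_mult gcd_dvd1 gcd_dvd2 mult.commute)
        then show ?thesis by simp
      qed
      ultimately show False
        using A pow by (auto simp: primitive_roots_unity_def)
    qed
  next
    assume "coprime k n"
    then have "n dvd j * k \<longleftrightarrow> n dvd j" for j
      by (simp add: coprime_commute coprime_dvd_mult_left_iff)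
    then show "?c k \<in> primitive_roots_unity n"
      using pow by (auto simp: primitive_roots_unity_def dest: nat_dvd_not_less)
  qed
  have tot: "totatives n = {k\<in>{..<n}. coprime k n}"
  proof -
    have "k \<in> totatives n \<longleftrightarrow> k < n \<and> coprime k n" for k
      using assms by (cases "k = 0"; cases "k = n") (auto simp: totatives_def)
    then show ?thesis
      by blast
  qed
  have bij: "bij_betw ?c {..<n} {z. z ^ n = 1}"
    by (rule bij_betw_roots_unity[OF n])
  show ?thesis
  proof (rule bij_betw_imageI)
    show "inj_on ?c (totatives n)"
      using bij_betw_imp_inj_on[OF bij] by (rule inj_on_subset) (auto simp: tot)
    show "?c ` totatives n = primitive_roots_unity n"
    proof
      show "?c ` totatives n \<subseteq> primitive_roots_unity n"
        using prim by (auto simp: tot)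
      show "primitive_roots_unity n \<subseteq> ?c ` totatives n"
      proof
        fix z assume z: "z \<in> primitive_roots_unity n"
        then have "z \<in> ?c ` {..<n}"
          using bij_betw_imp_surj_on[OF bij] by (simp add: primitive_roots_unity_def)
        with z prim show "z \<in> ?c ` totatives n"
          by (auto simp: tot)
      qed
    qed
  qed
qed

lemma card_primitive_roots_unity:
  assumes "n \<ge> 2"
  shows "card (primitive_roots_unity n) = totient n"
  using bij_betw_same_card[OF bij_betw_primitive_roots_unity[OF assms]] by (simp add: totient_def)

end

theory Submission
  imports Defs
begin

text \<open>The columns of \<open>V\<^sup>-\<^sup>1\<close> hold the coefficients of the Lagrange polynomials
  \<open>Q\<^sub>j / Q\<^sub>j(\<zeta>\<^sub>j)\<close> with \<open>Q\<^sub>j = \<Phi>\<^sub>n / (x - \<zeta>\<^sub>j)\<close>. Synthetic division bounds the coefficients of \<open>Q\<^sub>j\<close>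
  by \<open>m A(n)\<close>. To bound \<open>Q\<^sub>j(\<zeta>\<^sub>j)\<close> from below, sieve the \<open>n\<close>-th roots of unity by one prime divisor of
  \<open>n\<close> at a time. If \<open>P(S, d)\<close> is the product of \<open>\<zeta>\<^sub>j - z\<close> over all \<open>z \<noteq> \<zeta>\<^sub>j\<close> with \<open>z\<^sup>d = 1\<close> and
  \<open>z^(d/q) \<noteq> 1\<close> for \<open>q \<in> S\<close>, then \<open>P(S \<union> {p}, d) P(S, d/p) = P(S, d)\<close>, while
  \<open>P(\<emptyset>, d)\<close> is \<open>\<zeta>\<^sub>j\<^sup>d - 1\<close> or, for \<open>d = n\<close>, equals \<open>n \<zeta>\<^sub>j^(n-1)\<close>, of modulus between \<open>1/n\<close> and \<open>n\<close>. Each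
  sieving step at most squares these bounds, so \<open>\<bar>Q\<^sub>j(\<zeta>\<^sub>j)\<bar> \<ge> n^(-2^k)\<close>.\<close>

section \<open>Roots of unity and products of their differences\<close>

lemma power_gcd_eq_1:
  fixes z :: "'a::monoid_mult"
  assumes "z ^ a = 1" "z ^ b = 1"
  shows "z ^ gcd a b = 1"
proof (cases "a = 0")
  case False
  \<comment> \<open>Bezout without subtraction: elements of a monoid need not have inverses.\<close>
  then obtain x y where "a * x = b * y + gcd a b"
    using bezout_nat by blast
  then have "z ^ (a * x) = z ^ (b * y) * z ^ gcd a b"
    by (simp add: power_add)
  then show ?thesis
    using assms by (simp add: power_mult)
qed (use assms in simp)

lemma power_eq_1_dvd:
  fixes z :: "'a::monoid_mult"
  assumes "z ^ a = 1" "a dvd b"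
  shows "z ^ b = 1"
  using assms by (auto simp: power_mult elim!: dvdE)

text \<open>Both sides are monic of degree \<open>d\<close>, so a nonzero difference would have
  degree below \<open>d\<close> and yet vanish at all \<open>d\<close> roots of unity.\<close>

lemma monom_minus_1_eq_prod_roots_unity:
  assumes "d > 0"
  shows "monom 1 d - 1 = (\<Prod>z | z ^ d = (1::complex). [:- z, 1:])"
proof -
  let ?R = "{z::complex. z ^ d = 1}"
  let ?f = "monom 1 d - 1 :: complex poly" and ?g = "\<Prod>z\<in>?R. [:- z, 1:]"
  have card: "card ?R = d"
    by (rule card_roots_unity_eq[OF assms])
  have fin: "finite ?R"
    using assms by (intro finite_roots_unity) simp
  have deg_g: "degree ?g = d"
    using card by (simp add: degree_prod_sum_eq)
  have lead_g: "coeff ?g d = 1"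
    using lead_coeff_prod[of "\<lambda>z. [:- z, 1:]" ?R] deg_g by simp
  have coeffs: "coeff (?f - ?g) i = 0" if "i \<ge> d" for i
    using that assms deg_g lead_g by (cases "i = d") (auto simp: coeff_eq_0)
  have "?f - ?g = 0"
  proof (rule ccontr)
    assume nz: "?f - ?g \<noteq> 0"
    have "?R \<subseteq> {x. poly (?f - ?g) x = 0}"
      using fin by (auto simp: poly_monom poly_prod)
    then have "d \<le> card {x. poly (?f - ?g) x = 0}"
      using card card_mono[OF poly_roots_finite[OF nz]] by metis
    also have "\<dots> \<le> degree (?f - ?g)"
      by (rule card_poly_roots_bound[OF nz])
    finally show False
      using coeffs nz leading_coeff_0_iff by blast
  qed
  then show ?thesis by simp
qed

text \<open>Evaluate the factorization of X^d - 1 at \<open>w\<close>. If \<open>w\<close> is itself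
  a root, its factor is split off and the remaining product is the derivative at
  \<open>w\<close>.\<close>

lemma prod_diff_roots_unity:
  fixes w :: complex
  assumes "d > 0"
  shows "(\<Prod>z\<in>{z. z ^ d = 1} - {w}. w - z) = (if w ^ d = 1 then of_nat d * w ^ (d - 1) else w ^ d - 1)"
proof -
  let ?R = "{z::complex. z ^ d = 1}"
  have fin: "finite ?R"
    using assms by (intro finite_roots_unity) simp
  let ?q = "\<Prod>z\<in>?R - {w}. [:- z, 1:]"
  have q: "poly ?q w = (\<Prod>z\<in>?R - {w}. w - z)"
    by (simp add: poly_prod)
  show ?thesis
  proof (cases "w ^ d = 1")
    case True
    then have "monom 1 d - 1 = [:- w, 1:] * ?q"
      using fin by (simp add: monom_minus_1_eq_prod_roots_unity[OF assms] prod.remove[of _ w])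
    then have "poly (pderiv (monom 1 d - 1)) w = poly (pderiv ([:- w, 1:] * ?q)) w"
      by simp
    then show ?thesis
      using True q by (simp add: pderiv_diff pderiv_monom poly_monom pderiv_mult pderiv_pCons del: mult_pCons_left)
  next
    case False
    then have "poly (monom 1 d - 1) w = poly ?q w"
      by (simp add: monom_minus_1_eq_prod_roots_unity[OF assms])
    then show ?thesis
      using False q by (simp add: poly_monom)
  qed
qed

text \<open>The powers of \<open>w\<close> sum to 0, so \<open>n\<close> is the sum of the
  \<open>1 - w ^ j\<close>. Each has modulus at most n |w - 1|, hence n \<le> n^2 |w - 1|.\<close>

lemma norm_root_unity_minus_1_ge:
  fixes w :: complex
  assumes "w ^ n = 1" "w \<noteq> 1" "n > 0"
  shows "1 / real n \<le> norm (w - 1)"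
proof -
  have w: "norm w = 1"
    using power_eq_1_iff[OF assms(1)] assms(3) by simp
  have "(\<Sum>j<n. w ^ j) = 0"
    using assms by (simp add: geometric_sum)
  then have "of_nat n = (\<Sum>j<n. 1 - w ^ j)"
    by (simp add: sum_subtractf)
  then have "real n \<le> (\<Sum>j<n. norm (w ^ j - 1))"
    by (metis (no_types, lifting) norm_minus_commute norm_of_nat norm_sum sum.cong)
  also have "\<dots> \<le> (\<Sum>j<n. real n * norm (w - 1))"
  proof (rule sum_mono)
    fix j assume j: "j \<in> {..<n}"
    have "norm (w ^ j - 1 ^ j) \<le> real j * norm (w - 1)"
      by (rule norm_power_diff) (use w in auto)
    also have "\<dots> \<le> real n * norm (w - 1)"
      using j by (intro mult_right_mono) auto
    finally show "norm (w ^ j - 1) \<le> real n * norm (w - 1)" by simp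
  qed
  finally show ?thesis
    using assms by (simp add: field_simps)
qed

section \<open>Sieving the roots of unity by primes\<close>

definition sieved_roots :: "nat set \<Rightarrow> nat \<Rightarrow> complex set" where
  "sieved_roots S d = {z. z ^ d = 1 \<and> (\<forall>q\<in>S. z ^ (d div q) \<noteq> 1)}"

lemma finite_sieved_roots:
  assumes "d > 0"
  shows "finite (sieved_roots S d)"
proof -
  have "finite {z::complex. z ^ d = 1}"
    using assms by (intro finite_roots_unity) simp
  then show ?thesis
    by (rule finite_subset[rotated]) (auto simp: sieved_roots_def)
qed

text \<open>If z^k = 1 with 0 < k < n, then already z^g = 1 for the proper divisor g = gcd k n. A
  prime \<open>q\<close> dividing n/g makes g divide n/q, so sieving by \<open>q\<close> has removed
  \<open>z\<close>.\<close>

lemma sieved_roots_prime_factors: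
  assumes "n \<ge> 2"
  shows "sieved_roots (prime_factors n) n = primitive_roots_unity n"
proof (intro equalityI subsetI)
  fix z assume z: "z \<in> sieved_roots (prime_factors n) n"
  have "z ^ k \<noteq> 1" if k: "0 < k" "k < n" for k
  proof
    assume "z ^ k = 1"
    then have g: "z ^ gcd k n = 1"
      using z by (intro power_gcd_eq_1) (auto simp: sieved_roots_def)
    obtain e where e: "n = gcd k n * e"
      by (meson dvdE gcd_dvd2)
    have "e \<noteq> 1"
      using e k by (metis gcd_dvd1 mult.right_neutral nat_dvd_not_less)
    then obtain q where q: "prime q" "q dvd e"
      using prime_factor_nat by blast
    then have "q \<in> prime_factors n"
      using e assms by (metis dvd_mult in_prime_factors_iff not_numeral_le_zero)
    moreover have "gcd k n dvd n div q"
      using e q by (metis dvd_triv_left div_mult_swap)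
    ultimately show False
      using z power_eq_1_dvd[OF g] by (auto simp: sieved_roots_def)
  qed
  then show "z \<in> primitive_roots_unity n"
    using z by (auto simp: sieved_roots_def primitive_roots_unity_def)
next
  fix z assume z: "z \<in> primitive_roots_unity n"
  have "0 < n div q \<and> n div q < n" if "q \<in> prime_factors n" for q
    using that assms
    by (auto simp: in_prime_factors_iff div_greater_zero_iff dvd_imp_le prime_gt_0_nat
        intro!: div_less_dividend prime_gt_Suc_0_nat)
  then show "z \<in> sieved_roots (prime_factors n) n"
    using z by (auto simp: sieved_roots_def primitive_roots_unity_def)
qed

text \<open>Sieving by \<open>p\<close> removes the \<open>z\<close> with z^(d/p) = 1. For these,
  the conditions for q in \<open>S\<close> at levels \<open>d\<close> and d/p agree, since gcd(d/p,
  d/q) = d/(pq).\<close>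

lemma sieved_roots_insert:
  assumes d: "d > 0" and p: "prime p" "p dvd d" "p \<notin> S"
    and S: "\<And>q. q \<in> S \<Longrightarrow> prime q \<and> q dvd d"
  shows "sieved_roots S d = sieved_roots (insert p S) d \<union> sieved_roots S (d div p)"
    and "sieved_roots (insert p S) d \<inter> sieved_roots S (d div p) = {}"
proof -
  have iff: "z ^ (d div q) = 1 \<longleftrightarrow> z ^ (d div p div q) = 1"
    if z: "z ^ (d div p) = 1" and q: "q \<in> S" for z :: complex and q
  proof -
    have co: "coprime p q"
      using p S[OF q] q by (metis primes_coprime)
    then have "p * q dvd d"
      using p S[OF q] by (simp add: divides_mult)
    then obtain e where e: "d = p * q * e" ..
    have nz: "p > 0" "q > 0"
      using p S[OF q] by (auto simp: prime_gt_0_nat)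
    have div: "d div p = q * e" "d div q = p * e"
      using nz by (simp_all add: e mult.assoc mult.left_commute[of p q])
    have div2: "d div p div q = e"
      using nz by (simp add: div)
    have "gcd (q * e) (p * e) = e"
      using co by (simp add: gcd_mult_distrib_nat[symmetric] mult.commute[of _ e] coprime_commute)
    then show ?thesis
      using z power_gcd_eq_1[of z "q * e" "p * e"] power_eq_1_dvd[of z e "p * e"]
      unfolding div2 unfolding div by (metis dvd_triv_right)
  qed
  have "z ^ d = 1" if "z ^ (d div p) = 1" for z :: complex
    using power_eq_1_dvd[OF that] p by (metis dvd_div_mult_self dvd_triv_left)
  then show "sieved_roots S d = sieved_roots (insert p S) d \<union> sieved_roots S (d div p)"
    using iff by (auto simp: sieved_roots_def)
  show "sieved_roots (insert p S) d \<inter> sieved_roots S (d div p) = {}"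
    by (auto simp: sieved_roots_def)
qed

lemma norm_primitive_root:
  assumes "w \<in> primitive_roots_unity n" "n > 0"
  shows "norm w = 1"
  using assms power_eq_1_iff[of w n] by (auto simp: primitive_roots_unity_def)

text \<open>The bound is two-sided because the induction step divides by the product for d/p: a
  lower bound on the quotient needs an upper bound on the divisor. \<open>w\<close> stays fixed
  while \<open>d\<close> varies over divisors of \<open>n\<close>.\<close>

lemma norm_prod_diff_sieved_roots:
  assumes n: "n \<ge> 2" and w: "w \<in> primitive_roots_unity n"
    and "finite S" "d dvd n" "\<And>q. q \<in> S \<Longrightarrow> prime q \<and> q dvd d"
  shows "norm (\<Prod>z\<in>sieved_roots S d - {w}. w - z) \<in> {1 / real n ^ 2 ^ card S..real n ^ 2 ^ card S}"
  using assms(3-5)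
proof (induction S arbitrary: d rule: finite_induct)
  case empty
  have d: "d > 0" "d \<le> n"
    using empty n by (auto intro!: Nat.gr0I dvd_imp_le)
  have nw: "norm w = 1"
    using norm_primitive_root[OF w] n by simp
  have wn: "w ^ n = 1"
    using w by (simp add: primitive_roots_unity_def)
  show ?case
  proof (cases "w ^ d = 1")
    case True
    \<comment> \<open>\<open>w\<close> has order exactly \<open>n\<close>, so the product is n
      w^(n-1), of modulus \<open>n\<close>.\<close>
    then have "d = n"
      using w d by (auto simp: primitive_roots_unity_def)
    then show ?thesis
      using d n True nw
      by (simp add: sieved_roots_def prod_diff_roots_unity norm_mult norm_power)
        (simp add: divide_le_eq flip: power2_eq_square)
  next
    case False
    \<comment> \<open>\<open>w ^ d\<close> is an \<open>n\<close>-th root of unity other than 1,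
      which gives the lower bound; the upper bound is 2 \<le> n.\<close>
    have "(w ^ d) ^ n = 1"
      using wn by (metis power_mult mult.commute power_one)
    then have "1 / real n \<le> norm (w ^ d - 1)"
      using False n by (intro norm_root_unity_minus_1_ge) auto
    moreover have "norm (w ^ d - 1) \<le> norm (w ^ d) + norm (1::complex)"
      by (rule norm_triangle_ineq4)
    ultimately show ?thesis
      using d n False nw prod_diff_roots_unity[of d w]
      by (simp add: sieved_roots_def norm_power del: Diff_insert0)
  qed
next
  case (insert p S)
  have d: "d > 0"
    using insert.prems n by (auto intro!: Nat.gr0I)
  have p: "prime p" "p dvd d"
    using insert.prems by auto
  have "d div p dvd d"
    using p by (metis dvd_div_mult_self dvd_triv_left)
  then have ddp: "d div p dvd n" "d div p > 0"
    using d insert.prems(1) by (auto intro: dvd_trans dvd_pos_nat)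
  \<comment> \<open>The primes in \<open>S\<close> differ from \<open>p\<close>, so they still
    divide d/p and the induction hypothesis applies there.\<close>
  have S: "prime q \<and> q dvd d div p" if "q \<in> S" for q
  proof -
    have q: "prime q" "q dvd d"
      using that insert.prems by auto
    have "coprime q p"
      using p q that insert.hyps by (metis primes_coprime)
    then show ?thesis
      using q p by (metis coprime_dvd_mult_left_iff dvd_div_mult_self)
  qed
  let ?P = "\<lambda>S d. \<Prod>z\<in>sieved_roots S d - {w}. w - z"
  let ?B = "real n ^ 2 ^ card S"
  have "?P S d = ?P (insert p S) d * ?P S (d div p)"
    using sieved_roots_insert[of d p S] d p insert.prems insert.hyps
      finite_sieved_roots[OF d] finite_sieved_roots[OF ddp(2)]
    by (subst prod.union_disjoint[symmetric]) (auto simp: Un_Diff intro!: prod.cong)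
  then have eq: "norm (?P S d) = norm (?P (insert p S) d) * norm (?P S (d div p))"
    by (simp add: norm_mult)
  have B: "?B > 0" using n by simp
  have 1: "norm (?P S d) \<in> {1 / ?B..?B}" "norm (?P S (d div p)) \<in> {1 / ?B..?B}"
    using insert.IH[of d] insert.IH[of "d div p"] insert.prems S ddp by auto
  have pos: "norm (?P S (d div p)) > 0"
    using 1(2) less_le_trans[of 0 "1 / ?B"] B unfolding atLeastAtMost_iff zero_less_divide_1_iff by blast
  have X: "norm (?P (insert p S) d) = norm (?P S d) / norm (?P S (d div p))"
    using eq pos by (simp add: field_simps)
  have "(1 / ?B) / ?B \<le> norm (?P (insert p S) d)"
    unfolding X using 1 pos B by (intro frac_le) auto
  moreover have "norm (?P (insert p S) d) \<le> ?B / (1 / ?B)"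
    unfolding X using 1 pos B by (intro frac_le) auto
  moreover have "real n ^ 2 ^ card (insert p S) = ?B * ?B"
    using insert.hyps by (simp add: mult_2 power_add)
  ultimately show ?case by simp
qed

lemma norm_prod_diff_primitive_roots_ge:
  assumes "n \<ge> 2" "w \<in> primitive_roots_unity n"
  shows "1 / real n ^ 2 ^ card (prime_factors n) \<le> norm (\<Prod>z\<in>primitive_roots_unity n - {w}. w - z)"
  using norm_prod_diff_sieved_roots[OF assms, of "prime_factors n" n]
  by (auto simp: sieved_roots_prime_factors assms)

section \<open>Coefficient bounds, matrix norms and the explicit inverse\<close>

lemma norm_coeff_linear_cofactor_le:
  fixes q :: "'a::real_normed_field poly"
  assumes z: "norm z \<le> 1" and A: "\<And>i. norm (coeff ([:- z, 1:] * q) i) \<le> A"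
  shows "norm (coeff q i) \<le> real (degree q + 1) * A"
proof -
  have A0: "A \<ge> 0"
    using A[of 0] norm_ge_zero order_trans by blast
  have step: "norm (coeff q i) \<le> A + norm (coeff q (Suc i))" for i
  proof -
    \<comment> \<open>Synthetic division from the top down: as |z| \<le> 1, each step adds at most
      \<open>A\<close>.\<close>
    have "coeff q i = coeff ([:- z, 1:] * q) (Suc i) + z * coeff q (Suc i)"
      by simp
    then have "norm (coeff q i) \<le> norm (coeff ([:- z, 1:] * q) (Suc i)) + norm (z * coeff q (Suc i))"
      by (metis norm_triangle_ineq)
    also have "norm (z * coeff q (Suc i)) \<le> norm (coeff q (Suc i))"
      using z by (simp add: norm_mult mult_left_le_one_le)
    finally show ?thesis
      using A[of "Suc i"] by simp
  qed
  \<comment> \<open>The truncated difference is 0 exactly above the degree, where the coefficient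
    vanishes; this starts the induction.\<close>
  have "norm (coeff q i) \<le> real (degree q + 1 - i) * A" for i
  proof (induction "degree q + 1 - i" arbitrary: i)
    case 0
    then show ?case by (simp add: coeff_eq_0)
  next
    case (Suc t)
    then have "norm (coeff q (Suc i)) \<le> real t * A"
      using Suc.hyps(1)[of "Suc i"] by (metis Suc.hyps(2) Suc_eq_plus1 diff_Suc_Suc diff_Suc_1 diff_Suc_eq_diff_pred diff_commute)
    then show ?case
      using step[of i] unfolding Suc.hyps(2)[symmetric] by (simp add: algebra_simps)
  qed
  then show ?thesis
    by (rule order_trans) (intro mult_right_mono A0, simp)
qed

lemma cyclotomic_height_ge: "cmod (coeff (cyclotomic n) i) \<le> cyclotomic_height n"
proof (cases "i \<le> degree (cyclotomic n)")
  case True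
  then show ?thesis
    unfolding cyclotomic_height_def by (intro Max_ge) auto
next
  case False
  have "cmod (coeff (cyclotomic n) 0) \<le> cyclotomic_height n"
    unfolding cyclotomic_height_def by (intro Max_ge) auto
  then show ?thesis
    using False by (simp add: coeff_eq_0) (meson norm_ge_zero order_trans)
qed

lemma frobenius_norm_le:
  assumes "A \<in> carrier_mat m m" "b \<ge> 0"
    and "\<And>i j. i < m \<Longrightarrow> j < m \<Longrightarrow> cmod (A $$ (i, j)) \<le> b"
  shows "frobenius_norm A \<le> real m * b"
proof -
  have "(\<Sum>i<m. \<Sum>j<m. (cmod (A $$ (i, j)))\<^sup>2) \<le> (\<Sum>i<m. \<Sum>j<m. b\<^sup>2)"
    by (intro sum_mono power_mono assms) auto
  also have "\<dots> = (real m * b)\<^sup>2"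
    by (simp add: power2_eq_square algebra_simps)
  finally show ?thesis
    unfolding frobenius_norm_def using assms by (intro real_le_lsqrt) auto
qed

text \<open>Row \<open>i\<close> of the matrix times a column of coefficients evaluates that
  polynomial at \<open>\<zeta> i\<close>, and \<open>Q j\<close> vanishes at every node except
  \<open>\<zeta> j\<close>.\<close>

lemma mat_inverse_vandermonde_mat:
  assumes inj: "inj_on \<zeta> {..<m}"
  defines "Q \<equiv> \<lambda>j. \<Prod>z\<in>\<zeta> ` {..<m} - {\<zeta> j}. [:- z, 1:]"
  shows "mat_inverse (vandermonde_mat m \<zeta>) =
    Some (mat m m (\<lambda>(i, j). coeff (Q j) i / poly (Q j) (\<zeta> j)))" (is "_ = Some ?B")
proof -
  let ?V = "vandermonde_mat m \<zeta>"
  have V: "?V \<in> carrier_mat m m"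
    by (simp add: vandermonde_mat_def)
  obtain C where C: "mat_inverse ?V = Some C"
    using mat_inverse_invertible[OF invertible_vandermonde_mat[OF inj]] by blast
  note C' = mat_inverse(2)[OF V C]
  have "?V * ?B = 1\<^sub>m m"
  proof (rule eq_matI)
    fix i j assume "i < dim_row (1\<^sub>m m :: complex mat)" "j < dim_col (1\<^sub>m m :: complex mat)"
    then have ij: "i < m" "j < m" by auto
    have deg: "degree (Q j) < m"
      using ij card_image[OF inj] by (simp add: Q_def degree_prod_sum_eq)
    have nz: "poly (Q j) (\<zeta> j) \<noteq> 0"
      by (simp add: Q_def poly_prod)
    have "(?V * ?B) $$ (i, j) = (\<Sum>k<m. \<zeta> i ^ k * (coeff (Q j) k / poly (Q j) (\<zeta> j)))"
      using ij V by (simp add: vandermonde_mat_def scalar_prod_def lessThan_atLeast0)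
    also have "\<dots> = (\<Sum>k<m. coeff (Q j) k * \<zeta> i ^ k) / poly (Q j) (\<zeta> j)"
      by (simp add: sum_divide_distrib mult_ac)
    also have "(\<Sum>k<m. coeff (Q j) k * \<zeta> i ^ k) = poly (Q j) (\<zeta> i)"
      unfolding poly_altdef using deg
      by (intro sum.mono_neutral_right) (auto simp: coeff_eq_0)
    also have "poly (Q j) (\<zeta> i) / poly (Q j) (\<zeta> j) = (if i = j then 1 else 0)"
      using ij nz inj by (auto simp: Q_def poly_prod inj_on_def)
    finally show "(?V * ?B) $$ (i, j) = 1\<^sub>m m $$ (i, j)"
      using ij by simp
  qed (simp_all add: vandermonde_mat_def)
  \<comment> \<open>Associativity identifies the right inverse \<open>?B\<close> with the two-sided
    inverse \<open>C\<close> returned by \<open>mat_inverse\<close>.\<close>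
  then have "C = C * (?V * ?B)"
    using C' right_mult_one_mat[of C m m] by simp
  also have "\<dots> = C * ?V * ?B"
    using C' V by (intro assoc_mult_mat[symmetric]) auto
  also have "\<dots> = ?B"
    using C' by (simp add: left_mult_one_mat[of _ m m])
  finally have "C = ?B" .
  with C show ?thesis by simp
qed

section \<open>Assembling the bound on the condition number\<close>

theorem theorem3p10:
  fixes n k :: nat and p :: "nat \<Rightarrow> nat" and \<zeta> :: "nat \<Rightarrow> complex"
  assumes "n \<ge> 2"
    and "\<And>i. i \<in> {1..k} \<Longrightarrow> prime (p i)"
    and "inj_on p {1..k}"
    and "rad n = (\<Prod>i = 1..k. p i)"
    and "bij_betw \<zeta> {..<totient n} (primitive_roots_unity n)"
  shows "cond_number (vandermonde_mat (totient n) \<zeta>)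
           \<le> 2 * real (rad n) * real n ^ (2 ^ k + k + 2) * cyclotomic_height n"
proof -
  let ?m = "totient n" and ?R = "primitive_roots_unity n" and ?A = "cyclotomic_height n"
  let ?V = "vandermonde_mat ?m \<zeta>"
  have n: "n \<noteq> 0" using assms(1) by simp
  have inj: "inj_on \<zeta> {..<?m}" and img: "\<zeta> ` {..<?m} = ?R"
    using assms(5) by (auto simp: bij_betw_def)
  have R: "finite ?R" "card ?R = ?m"
    using finite_sieved_roots[of n "prime_factors n"] n
    by (simp_all add: sieved_roots_prime_factors card_primitive_roots_unity assms(1))
  have A0: "?A \<ge> 0"
    using cyclotomic_height_ge[of n 0] norm_ge_zero order_trans by blast
  \<comment> \<open>A prime factor of \<open>n\<close> divides the product of the
    \<open>p i\<close>, hence equals one of these primes.\<close>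
  have "prime_factors n \<subseteq> p ` {1..k}"
  proof
    fix q assume q: "q \<in> prime_factors n"
    then have "q dvd rad n"
      unfolding rad_def by (intro dvd_prodI) auto
    then obtain i where "i \<in> {1..k}" "q dvd p i"
      using q unfolding assms(4) by (auto simp: prime_dvd_prod_iff in_prime_factors_iff)
    then show "q \<in> p ` {1..k}"
      using q assms(2) primes_dvd_imp_eq by (metis image_eqI in_prime_factors_imp_prime)
  qed
  then have ck: "card (prime_factors n) \<le> k"
    by (metis card_atLeastAtMost card_image_le card_mono diff_Suc_1 finite_atLeastAtMost finite_imageI order_trans)
  obtain q where "prime q" "q dvd n"
    using prime_factor_nat[of n] assms(1) by auto
  then have "q \<in> prime_factors n"
    using n by (simp add: in_prime_factors_iff)
  then have "card (prime_factors n) > 0"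
    by (auto simp: card_gt_0_iff)
  with ck have k: "k \<ge> 1" by simp
  have rad: "rad n \<ge> 1"
    unfolding rad_def by (auto simp: Suc_le_eq intro!: prod_pos dest: in_prime_factors_imp_prime prime_gt_0_nat)
  let ?B = "real n ^ 2 ^ k"
  define Q where "Q j = (\<Prod>z\<in>?R - {\<zeta> j}. [:- z, 1:])" for j
  define C where "C = mat ?m ?m (\<lambda>(i, j). coeff (Q j) i / poly (Q j) (\<zeta> j))"
  have inv: "mat_inverse ?V = Some C"
    using mat_inverse_vandermonde_mat[OF inj] by (simp add: Q_def C_def img)
  have entry: "cmod (C $$ (i, j)) \<le> real ?m * ?A * ?B" if ij: "i < ?m" "j < ?m" for i j
  proof -
    have z: "\<zeta> j \<in> ?R" using ij img by blast
    have "cyclotomic n = [:- \<zeta> j, 1:] * Q j"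
      unfolding cyclotomic_def Q_def by (rule prod.remove[OF R(1) z])
    moreover have "norm (\<zeta> j) \<le> 1"
      using norm_primitive_root[OF z] n by simp
    ultimately have "cmod (coeff (Q j) i) \<le> real (degree (Q j) + 1) * ?A"
      by (metis norm_coeff_linear_cofactor_le cyclotomic_height_ge)
    moreover have "degree (Q j) + 1 = ?m"
      using R z ij by (simp add: Q_def degree_prod_sum_eq)
    ultimately have num: "cmod (coeff (Q j) i) \<le> real ?m * ?A" by metis
    \<comment> \<open>The sieve bound has exponent 2^(number of prime factors), which is raised to
      2^k.\<close>
    have "real n ^ 2 ^ card (prime_factors n) \<le> ?B"
      using ck assms(1) by (intro power_increasing) auto
    then have "1 / ?B \<le> 1 / real n ^ 2 ^ card (prime_factors n)"
      using n by (intro frac_le) auto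
    also have "\<dots> \<le> cmod (poly (Q j) (\<zeta> j))"
      using norm_prod_diff_primitive_roots_ge[OF assms(1) z] by (simp add: Q_def poly_prod)
    finally have "cmod (coeff (Q j) i) / cmod (poly (Q j) (\<zeta> j)) \<le> (real ?m * ?A) / (1 / ?B)"
      using num n A0 by (intro frac_le) auto
    then show ?thesis
      using ij by (simp add: C_def norm_divide)
  qed
  have "frobenius_norm C \<le> real ?m * (real ?m * ?A * ?B)"
    by (rule frobenius_norm_le) (use entry A0 in \<open>auto simp: C_def\<close>)
  moreover have "frobenius_norm ?V \<le> real ?m * 1"
  proof (rule frobenius_norm_le)
    fix i j assume "i < ?m" "j < ?m"
    moreover from this have "norm (\<zeta> i) = 1"
      using img n by (intro norm_primitive_root[of _ n]) auto
    ultimately show "cmod (?V $$ (i, j)) \<le> 1"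
      by (simp add: vandermonde_mat_def norm_power)
  qed (auto simp: vandermonde_mat_def)
  ultimately have "cond_number ?V \<le> (real ?m * 1) * (real ?m * (real ?m * ?A * ?B))"
    unfolding cond_number_def inv option.sel
    by (intro mult_mono) (auto simp: frobenius_norm_def intro!: sum_nonneg)
  also have "\<dots> = real ?m ^ 3 * ?B * ?A"
    by (simp add: power3_eq_cube)
  also have "\<dots> \<le> real n ^ (k + 2) * ?B * ?A"
  proof -
    \<comment> \<open>One factor \<open>?m\<close> comes from the coefficient bound and one from
      each Frobenius norm; 3 \<le> k + 2 because k \<ge> 1.\<close>
    have "real ?m ^ 3 \<le> real n ^ 3"
      by (intro power_mono) (auto simp: totient_le)
    also have "\<dots> \<le> real n ^ (k + 2)"
      using k assms(1) by (intro power_increasing) auto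
    finally show ?thesis
      using A0 by (intro mult_right_mono) auto
  qed
  also have "\<dots> = 1 * (real n ^ (2 ^ k + k + 2) * ?A)"
    by (simp add: power_add mult_ac)
  \<comment> \<open>The factor 2 rad(n) is at least 1 and is inserted here.\<close>
  also have "\<dots> \<le> (2 * real (rad n)) * (real n ^ (2 ^ k + k + 2) * ?A)"
    using rad A0 by (intro mult_right_mono) auto
  finally show ?thesis
    by (simp add: mult.assoc)
qed

end
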